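(* Let $R$ be a commutative Noetherian ring with identity, and let $\mathfrak{a}, \mathfrak{b}$ be proper ideals of $R$. If $\mathcal{P}_R(\mathfrak{a}) = \mathcal{P}_R(\mathfrak{b})$ and this common factorization is a product of at most two prime ideals (counted with multiplicity), then $\mathcal{P}_R(\mathfrak{a} \cap \mathfrak{b}) = \mathcal{P}_R(\mathfrak{a})$.
   Context: Throughout, $R$ is a commutative Noetherian ring with identity and $M$ is a finitely generated unitary $R$-module; ideals of $R$ are regarded as submodules of $M=R$. The symbol $\subset$ denotes proper inclusion. For submodules $N,K$ of $M$, $(N:K)=\{a\in R \mid aK\subseteq N\}$; for an ideal $I$ of $R$, $(N:I)=\{x\in M\mid Ix\subseteq N\}$. $\mathrm{Ass}(M/N)$ is the set of associated primes of $M/N$. Prime submodule: a proper submodule $N$ of $M$ is a $\mathfrak{p}$-prime submodule of $M$ if $(N:M)=\mathfrak{p}$ and for all $a\in R$, $x\in M$, $ax\in N$ implies $a\in (N:M)$ or $x\in N$ (then $\mathfrak p$ is a prime ideal). A submodule $K\supset N$ of $M$ is a $\mathfrak{p}$-prime extension of $N$, written $N\overset{\mathfrak p}{\subset}K$, if $N$ is a $\mathfrak{p}$-prime submodule of $K$. If $\mathfrak{p}$ is a maximal element (under inclusion) of $\mathrm{Ass}(M/N)$, then $(N:\mathfrak{p})$ is the unique maximal $\mathfrak{p}$-prime extension of $N$ in $M$, and it is called the regular $\mathfrak{p}$-prime extension of $N$ in $M$. RPE filtration: a filtration $N=M_0\overset{\mathfrak{p}_1}{\subset}M_1\subset\cdots\overset{\mathfrak{p}_n}{\subset}M_n=M$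 is a regular prime extension (RPE) filtration of $M$ over $N$ if each $M_i$ is a regular $\mathfrak{p}_i$-prime extension of $M_{i-1}$ in $M$, $1\le i\le n$. Factorization: for a proper submodule $N$ of $M$, RPE filtrations of $M$ over $N$ exist, and it is known that the number of occurrences of each prime ideal is the same in all of them. The generalized prime ideal factorization of $N$ in $M$ is the formal product $\mathcal{P}_M(N)=\mathfrak{p}_1\cdots\mathfrak{p}_n$ of the primes occurring in any RPE filtration of $M$ over $N$, i.e. the multiset of these primes; equality of two such factorizations means equality as multisets of prime ideals (not merely equality of the product ideals). *)

theory Defs
  imports "HOL-Algebra.Algebra" "HOL-Library.Multiset"
begin

definition self_module :: "('a, 'm) ring_scheme \<Rightarrow> ('a, 'a) module" where
  "self_module R = \<lparr>carrier = carrier R, monoid.mult = monoid.mult R, one = one R, ring.zero = ring.zero R,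
     add = add R, smult = monoid.mult R\<rparr>"

(* The record type of modules extends that of rings; the fields mult and one play no role in the
   locale module and are left unspecified. *)
definition quot_module :: "('a, 'b, 'm) module_scheme \<Rightarrow> 'b set \<Rightarrow> ('a, 'b set) module" where
  "quot_module M N = \<lparr>carrier = a_rcosets\<^bsub>M\<^esub> N, monoid.mult = undefined, one = undefined, ring.zero = N,
     add = set_add M, smult = (\<lambda>a C. \<Union>x\<in>C. N +>\<^bsub>M\<^esub> (a \<odot>\<^bsub>M\<^esub> x))\<rparr>"

definition annihilator :: "('a, 'r) ring_scheme \<Rightarrow> ('a, 'b, 'm) module_scheme \<Rightarrow> 'b \<Rightarrow> 'a set" where
  "annihilator R M x = {a \<in> carrier R. a \<odot>\<^bsub>M\<^esub> x = \<zero>\<^bsub>M\<^esub>}"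

definition assoc_primes :: "('a, 'r) ring_scheme \<Rightarrow> ('a, 'b, 'm) module_scheme \<Rightarrow> 'a set set" where
  "assoc_primes R M = {p. primeideal p R \<and> (\<exists>x\<in>carrier M. p = annihilator R M x)}"

definition colon_ideal ::
  "('a, 'r) ring_scheme \<Rightarrow> ('a, 'b, 'm) module_scheme \<Rightarrow> 'b set \<Rightarrow> 'b set \<Rightarrow> 'a set" where
  "colon_ideal R M N K = {a \<in> carrier R. \<forall>x\<in>K. a \<odot>\<^bsub>M\<^esub> x \<in> N}"

definition colon_submodule :: "('a, 'b, 'm) module_scheme \<Rightarrow> 'b set \<Rightarrow> 'a set \<Rightarrow> 'b set" where
  "colon_submodule M N I = {x \<in> carrier M. \<forall>a\<in>I. a \<odot>\<^bsub>M\<^esub> x \<in> N}"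

definition prime_submodule ::
  "('a, 'r) ring_scheme \<Rightarrow> ('a, 'b, 'm) module_scheme \<Rightarrow> 'a set \<Rightarrow> 'b set \<Rightarrow> bool" where
  "prime_submodule R M p N \<longleftrightarrow>
     submodule N R M \<and> N \<noteq> carrier M \<and> colon_ideal R M N (carrier M) = p \<and>
     (\<forall>a\<in>carrier R. \<forall>x\<in>carrier M.
        a \<odot>\<^bsub>M\<^esub> x \<in> N \<longrightarrow> a \<in> colon_ideal R M N (carrier M) \<or> x \<in> N)"

definition prime_extension ::
  "('a, 'r) ring_scheme \<Rightarrow> ('a, 'b, 'm) module_scheme \<Rightarrow> 'a set \<Rightarrow> 'b set \<Rightarrow> 'b set \<Rightarrow> bool" where
  "prime_extension R M p N K \<longleftrightarrow>
     submodule N R M \<and> submodule K R M \<and> N \<subset> K \<and> prime_submodule R (M\<lparr>carrier := K\<rparr>) p N"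

definition regular_prime_extension ::
  "('a, 'r) ring_scheme \<Rightarrow> ('a, 'b, 'm) module_scheme \<Rightarrow> 'a set \<Rightarrow> 'b set \<Rightarrow> 'b set \<Rightarrow> bool" where
  "regular_prime_extension R M p N K \<longleftrightarrow>
     prime_extension R M p N K \<and>
     p \<in> assoc_primes R (quot_module M N) \<and>
     (\<forall>q\<in>assoc_primes R (quot_module M N). p \<subseteq> q \<longrightarrow> q = p) \<and>
     K = colon_submodule M N p"

(* The list Ms holds M_0, ..., M_n; as lists are indexed from 0, the prime of the step from M_i to
   M_(i+1) is ps ! i. *)
definition rpe_filtration ::
  "('a, 'r) ring_scheme \<Rightarrow> ('a, 'b, 'm) module_scheme \<Rightarrow> 'b set \<Rightarrow> 'b set list \<Rightarrow> 'a set list \<Rightarrow> bool"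
where
  "rpe_filtration R M N Ms ps \<longleftrightarrow>
     length Ms = Suc (length ps) \<and> hd Ms = N \<and> last Ms = carrier M \<and>
     (\<forall>i<length ps. regular_prime_extension R M (ps ! i) (Ms ! i) (Ms ! Suc i))"

(* Meaningful because, for R Noetherian and M finitely generated, RPE filtrations over a proper
   submodule exist and all of them have the same multiset of primes. *)
definition gen_prime_factorization ::
  "('a, 'r) ring_scheme \<Rightarrow> ('a, 'b, 'm) module_scheme \<Rightarrow> 'b set \<Rightarrow> 'a set multiset" where
  "gen_prime_factorization R M N =
     (THE A. \<exists>Ms ps. rpe_filtration R M N Ms ps \<and> A = mset ps)"

lemma module_self_module:
  assumes "cring R"
  shows "module R (self_module R)"
proof -
  interpret cring R by fact
  show ?thesis
  proof (rule moduleI)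
    show "abelian_group (self_module R)"
    proof (rule abelian_groupI)
      fix x assume x: "x \<in> carrier (self_module R)"
      show "\<exists>y\<in>carrier (self_module R). y \<oplus>\<^bsub>self_module R\<^esub> x = \<zero>\<^bsub>self_module R\<^esub>"
        by (rule bexI[of _ "\<ominus>\<^bsub>R\<^esub> x"]) (use x in \<open>simp_all add: self_module_def l_neg\<close>)
    qed (simp_all add: self_module_def a_ac)
  qed (simp_all add: self_module_def l_distr r_distr m_assoc assms)
qed

lemma submodule_self_module_iff:
  assumes "cring R"
  shows "submodule I R (self_module R) \<longleftrightarrow> ideal I R"
proof -
  interpret cring R by fact
  have add: "subgroup I (add_monoid (self_module R)) \<longleftrightarrow> subgroup I (add_monoid R)"
    by (simp add: subgroup_def m_inv_def self_module_def)
  show ?thesis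
  proof
    assume s: "submodule I R (self_module R)"
    then have sub: "subgroup I (add_monoid R)"
      by (simp add: submodule_def add)
    have m: "x \<otimes>\<^bsub>R\<^esub> a \<in> I" if "a \<in> I" "x \<in> carrier R" for a x
      using submodule.smult_closed[OF s that(2) that(1)] by (simp add: self_module_def)
    have c: "a \<in> carrier R" if "a \<in> I" for a
      using subgroup.mem_carrier[OF sub that] by simp
    show "ideal I R"
    proof (rule idealI[OF ring_axioms sub])
      fix a x assume a: "a \<in> I" and x: "x \<in> carrier R"
      show "x \<otimes>\<^bsub>R\<^esub> a \<in> I" using a x by (rule m)
      then show "a \<otimes>\<^bsub>R\<^esub> x \<in> I" using m_comm[OF c[OF a] x] by simp
    qed
  next
    assume "ideal I R"
    then interpret I: ideal I R .
    have "subgroup I (add_monoid R)" by (rule I.a_subgroup)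
    then have "subgroup I (add_monoid (self_module R))" by (simp only: add)
    then show "submodule I R (self_module R)"
      by (rule submodule.intro)
        (simp add: submodule_axioms_def self_module_def I.I_l_closed)
  qed
qed

lemma quot_module_smult:
  assumes "module R M" "submodule N R M" "a \<in> carrier R" "x \<in> carrier M"
  shows "a \<odot>\<^bsub>quot_module M N\<^esub> (N +>\<^bsub>M\<^esub> x) = N +>\<^bsub>M\<^esub> (a \<odot>\<^bsub>M\<^esub> x)"
proof -
  interpret module R M by fact
  interpret N: submodule N R M by fact
  have sub: "subgroup N (add_monoid M)" by (rule N.subgroup_axioms)
  have "N +>\<^bsub>M\<^esub> (a \<odot>\<^bsub>M\<^esub> y) = N +>\<^bsub>M\<^esub> (a \<odot>\<^bsub>M\<^esub> x)" if "y \<in> N +>\<^bsub>M\<^esub> x" for y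
  proof -
    from that obtain n where n: "n \<in> N" "y = n \<oplus>\<^bsub>M\<^esub> x"
      by (auto simp: a_r_coset_def')
    have nc: "n \<in> carrier M" using n(1) N.subset by auto
    have "a \<odot>\<^bsub>M\<^esub> y = a \<odot>\<^bsub>M\<^esub> n \<oplus>\<^bsub>M\<^esub> a \<odot>\<^bsub>M\<^esub> x"
      using n nc assms by (simp add: smult_r_distr)
    then have "a \<odot>\<^bsub>M\<^esub> y \<in> N +>\<^bsub>M\<^esub> (a \<odot>\<^bsub>M\<^esub> x)"
      using n(1) assms(3) by (auto simp: a_r_coset_def')
    then show ?thesis
      using M.add.repr_independence[OF _ _ sub] assms(3,4)
      by (metis a_r_coset_def smult_closed)
  qed
  moreover have "x \<in> N +>\<^bsub>M\<^esub> x"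
    using M.add.rcos_self[OF _ sub] assms(4) by (simp add: a_r_coset_def)
  ultimately have "(\<Union>y\<in>N +>\<^bsub>M\<^esub> x. N +>\<^bsub>M\<^esub> (a \<odot>\<^bsub>M\<^esub> y)) = N +>\<^bsub>M\<^esub> (a \<odot>\<^bsub>M\<^esub> x)"
    by blast
  then show ?thesis
    by (simp add: quot_module_def)
qed

lemma mem_assoc_primes_quot_module_iff:
  assumes "module R M" "submodule N R M"
  shows "p \<in> assoc_primes R (quot_module M N) \<longleftrightarrow>
    primeideal p R \<and> (\<exists>x\<in>carrier M. p = {a \<in> carrier R. a \<odot>\<^bsub>M\<^esub> x \<in> N})"
proof -
  interpret module R M by fact
  interpret N: submodule N R M by fact
  have sub: "subgroup N (add_monoid M)" by (rule N.subgroup_axioms)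
  have coset: "N +>\<^bsub>M\<^esub> y = N \<longleftrightarrow> y \<in> N" if "y \<in> carrier M" for y
    using M.add.rcos_self[OF _ sub, of y] M.add.coset_join2[OF _ sub, of y] that
    by (auto simp: a_r_coset_def)
  have "annihilator R (quot_module M N) (N +>\<^bsub>M\<^esub> x) = {a \<in> carrier R. a \<odot>\<^bsub>M\<^esub> x \<in> N}"
    if "x \<in> carrier M" for x
  proof -
    have z: "\<zero>\<^bsub>quot_module M N\<^esub> = N" by (simp add: quot_module_def)
    have "a \<odot>\<^bsub>quot_module M N\<^esub> (N +>\<^bsub>M\<^esub> x) = \<zero>\<^bsub>quot_module M N\<^esub> \<longleftrightarrow> a \<odot>\<^bsub>M\<^esub> x \<in> N"
      if "a \<in> carrier R" for a
      unfolding z quot_module_smult[OF assms that \<open>x \<in> carrier M\<close>]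
      using that \<open>x \<in> carrier M\<close> by (intro coset) simp
    then show ?thesis
      unfolding annihilator_def by blast
  qed
  moreover have "carrier (quot_module M N) = (\<lambda>x. N +>\<^bsub>M\<^esub> x) ` carrier M"
    by (auto simp: quot_module_def A_RCOSETS_def')
  ultimately show ?thesis
    by (auto simp: assoc_primes_def)
qed

end

theory Submission
  imports Defs
begin

text \<open>Write \<open>(N : p)\<close> for \<open>colon_submodule M N p\<close>, and call the passage from \<open>N\<close> to \<open>(N : p)\<close>,
  for \<open>p\<close> maximal in \<open>Ass (M/N)\<close>, a step by \<open>p\<close>; it determines \<open>(N : p)\<close> from \<open>N\<close> and \<open>p\<close>.

  The factorization is defined by a definite description, so any statement about it rests on
  existence and uniqueness. Every proper submodule has a maximal associated prime, so steps can be
  made until \<open>M\<close> is reached, which happens by the ascending chain condition. Uniqueness is a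
  matter of confluence. Since \<open>Ass (M/(N : p))\<close> is contained in
  \<open>Ass (M/N)\<close> (\<open>Ass_colon_submodule_subset\<close>), a second maximal associated prime \<open>q\<close> of \<open>M/N\<close> is
  still maximal after the step by \<open>p\<close>, and \<open>((N : p) : q) = ((N : q) : p)\<close>. So two different
  first steps can be completed to a square in which opposite sides carry the same prime
  (\<open>regular_prime_extension_diamond\<close>), and the ascending chain condition propagates this to whole
  filtrations (\<open>rpe_filtration_exists_unique\<close>). In particular a step by \<open>p\<close> from \<open>N\<close> to \<open>K\<close> gives
  \<open>P(N) = p P(K)\<close>.

  If steps by the same \<open>p\<close> lead from \<open>N\<close> and from \<open>L\<close> to the same \<open>K\<close>, then a step by \<open>p\<close> also
  leads from \<open>N \<inter> L\<close> to \<open>K\<close> (\<open>regular_prime_extension_Int\<close>), so all three factorizations agree.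
  The theorem therefore reduces to finding a common first step for \<open>\<aa>\<close> and \<open>\<bb>\<close>
  (\<open>common_regular_step\<close>). A step by \<open>p\<close> to the whole ring starts at \<open>p\<close>, so the only filtration
  with a single prime \<open>p\<close> is \<open>p \<subset> R\<close>, and one with primes \<open>p, q\<close> in this order is
  \<open>I \<subset> q \<subset> R\<close> with \<open>(I : p) = q\<close>. The first steps of \<open>\<aa>\<close> and \<open>\<bb>\<close> can thus differ only if
  \<open>p\<close> and \<open>q\<close> occur in opposite orders, say \<open>p\<close> first over \<open>\<aa>\<close> and \<open>q\<close> first over \<open>\<bb>\<close>. Then
  \<open>q \<subset> p\<close> is impossible, because \<open>p\<close> is associated to \<open>R/\<bb>\<close> while \<open>q\<close> is maximal there; and if
  \<open>q\<close> is not contained in \<open>p\<close>, the two steps over \<open>\<aa>\<close> can be interchanged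
  (\<open>regular_step_swap\<close>), which gives \<open>\<aa>\<close> the first step of \<open>\<bb>\<close>.\<close>

section \<open>Noetherian modules and associated primes\<close>

text \<open>Two chain conditions enter: ideals are finitely generated, and submodules satisfy the
  ascending chain condition. The latter is phrased as well-foundedness of reverse inclusion, the
  form in which it drives the induction on filtrations; for finitely generated \<open>M\<close> it is a
  consequence of the former.\<close>

locale noetherian_module = module R M + noetherian_ring R
  for R (structure) and M (structure) +
  assumes wf_submodules: "wf {(K, N). submodule N R M \<and> submodule K R M \<and> N \<subset> K}"
begin

abbreviation Ass :: "'c set \<Rightarrow> 'a set set" where
  "Ass N \<equiv> assoc_primes R (quot_module M N)"

abbreviation ann :: "'c set \<Rightarrow> 'c \<Rightarrow> 'a set" where
  "ann N x \<equiv> colon_ideal R M N {x}"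

lemma mem_ann_iff: "a \<in> ann N x \<longleftrightarrow> a \<in> carrier R \<and> a \<odot>\<^bsub>M\<^esub> x \<in> N"
  by (simp add: colon_ideal_def)

lemma mem_colon_submodule_iff:
  "x \<in> colon_submodule M N I \<longleftrightarrow> x \<in> carrier M \<and> (\<forall>a\<in>I. a \<odot>\<^bsub>M\<^esub> x \<in> N)"
  by (simp add: colon_submodule_def)

lemma mem_Ass_iff:
  assumes "submodule N R M"
  shows "p \<in> Ass N \<longleftrightarrow> primeideal p R \<and> (\<exists>x\<in>carrier M. p = ann N x)"
  using mem_assoc_primes_quot_module_iff[OF module_axioms assms]
  by (simp add: colon_ideal_def)

lemma smult_swap:
  assumes "a \<in> carrier R" "b \<in> carrier R" "x \<in> carrier M"
  shows "a \<odot>\<^bsub>M\<^esub> (b \<odot>\<^bsub>M\<^esub> x) = b \<odot>\<^bsub>M\<^esub> (a \<odot>\<^bsub>M\<^esub> x)"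
  using assms smult_assoc1 m_comm by metis

lemma zero_mem_submodule:
  assumes "submodule N R M"
  shows "\<zero>\<^bsub>M\<^esub> \<in> N"
  using subgroup.one_closed[OF submodule.axioms(1)[OF assms]] by simp

lemma ideal_ann:
  assumes N: "submodule N R M" and x: "x \<in> carrier M"
  shows "ideal (ann N x) R"
proof (rule idealI[OF R.ring_axioms])
  note E = submoduleE[OF N]
  show "subgroup (ann N x) (add_monoid R)"
  proof (rule R.add.subgroupI)
    show "ann N x \<subseteq> carrier R"
      by (auto simp: mem_ann_iff)
    have "\<zero> \<in> ann N x"
      using x zero_mem_submodule[OF N] by (simp add: mem_ann_iff)
    then show "ann N x \<noteq> {}" by blast
    show "\<ominus> a \<in> ann N x" if "a \<in> ann N x" for a
      using that x E(3) by (simp add: mem_ann_iff smult_l_minus)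
    show "a \<oplus> b \<in> ann N x" if "a \<in> ann N x" "b \<in> ann N x" for a b
      using that x E(5) by (simp add: mem_ann_iff smult_l_distr)
  qed
  show ba: "b \<otimes> a \<in> ann N x" if "a \<in> ann N x" "b \<in> carrier R" for a b
    using that x E(4) by (simp add: mem_ann_iff smult_assoc1)
  show "a \<otimes> b \<in> ann N x" if "a \<in> ann N x" "b \<in> carrier R" for a b
    using ba[OF that] that m_comm by (simp add: mem_ann_iff)
qed

lemma submodule_colon_submodule:
  assumes N: "submodule N R M" and I: "I \<subseteq> carrier R"
  shows "submodule (colon_submodule M N I) R M"
proof (rule submoduleI)
  note E = submoduleE[OF N]
  show "colon_submodule M N I \<subseteq> carrier M"
    by (auto simp: mem_colon_submodule_iff)
  show "\<zero>\<^bsub>M\<^esub> \<in> colon_submodule M N I"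
    using I zero_mem_submodule[OF N] by (auto simp: mem_colon_submodule_iff)
  show "\<ominus>\<^bsub>M\<^esub> x \<in> colon_submodule M N I" if "x \<in> colon_submodule M N I" for x
    using that I E(3) by (auto simp: mem_colon_submodule_iff smult_r_minus subset_iff)
  show "x \<oplus>\<^bsub>M\<^esub> y \<in> colon_submodule M N I"
    if "x \<in> colon_submodule M N I" "y \<in> colon_submodule M N I" for x y
    using that I E(5) by (auto simp: mem_colon_submodule_iff smult_r_distr subset_iff)
  show "a \<odot>\<^bsub>M\<^esub> x \<in> colon_submodule M N I"
    if "a \<in> carrier R" "x \<in> colon_submodule M N I" for a x
    using that I E(4) smult_swap[of _ a x] by (auto simp: mem_colon_submodule_iff subset_iff)
qed

lemma subset_colon_submodule:
  assumes "submodule N R M" "I \<subseteq> carrier R"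
  shows "N \<subseteq> colon_submodule M N I"
  using submoduleE(1,4)[OF assms(1)] assms(2)
  by (auto simp: mem_colon_submodule_iff subset_iff)

lemma submodule_Int:
  assumes "submodule N R M" "submodule L R M"
  shows "submodule (N \<inter> L) R M"
  using submoduleE(1,3,4,5)[OF assms(1)] submoduleE(1,3,4,5)[OF assms(2)]
    zero_mem_submodule[OF assms(1)] zero_mem_submodule[OF assms(2)]
  by (intro submoduleI) auto

text \<open>An annihilator that is maximal among the annihilators of nonzero elements of \<open>M/N\<close> is
  prime: for \<open>b y \<noteq> 0\<close> the annihilators of \<open>y\<close> and \<open>b y\<close> agree by maximality. The ascending
  chain condition on ideals provides such an annihilator above any given one.\<close>

lemma ann_subset_associated_prime:
  assumes N: "submodule N R M" and x: "x \<in> carrier M" "x \<notin> N"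
  obtains p where "p \<in> Ass N" "ann N x \<subseteq> p"
proof -
  define S where "S = {ann N y |y. y \<in> carrier M \<and> y \<notin> N \<and> ann N x \<subseteq> ann N y}"
  have "\<exists>m\<in>S. \<forall>J\<in>S. m \<subseteq> J \<longrightarrow> J = m"
  proof (rule subset_Zorn_nonempty)
    show "S \<noteq> {}" using x unfolding S_def by blast
    fix C assume C: "C \<noteq> {}" "subset.chain S C"
    have "S \<subseteq> {I. ideal I R}" using ideal_ann[OF N] by (auto simp: S_def)
    then have "subset.chain {I. ideal I R} C"
      using C(2) by (auto simp: subset_chain_def)
    from ideal_chain_is_trivial[OF C(1) this] show "\<Union>C \<in> S"
      using C(2) by (auto simp: subset_chain_def)
  qed
  then obtain m where m: "m \<in> S" "\<forall>J\<in>S. m \<subseteq> J \<longrightarrow> J = m" ..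
  from m(1) obtain y where y: "y \<in> carrier M" "y \<notin> N" "ann N x \<subseteq> ann N y"
    and my: "m = ann N y"
    unfolding S_def by blast
  have max: "J = ann N y" if "J \<in> S" "ann N y \<subseteq> J" for J
    using m(2) that unfolding my by simp
  have "primeideal (ann N y) R"
  proof (rule primeidealI[OF ideal_ann[OF N y(1)] R.is_cring])
    have "\<one> \<notin> ann N y" using y by (simp add: mem_ann_iff)
    then show "carrier R \<noteq> ann N y" by blast
    fix a b assume ab: "a \<in> carrier R" "b \<in> carrier R" "a \<otimes> b \<in> ann N y"
    show "a \<in> ann N y \<or> b \<in> ann N y"
    proof (cases "b \<in> ann N y")
      case False
      let ?z = "b \<odot>\<^bsub>M\<^esub> y"
      have z: "?z \<in> carrier M" "?z \<notin> N"
        using False ab y by (auto simp: mem_ann_iff)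
      have sub: "ann N y \<subseteq> ann N ?z"
        using submoduleE(4)[OF N ab(2)] smult_swap[OF _ ab(2) y(1)] by (auto simp: mem_ann_iff)
      then have "ann N ?z \<in> S" using z y(3) unfolding S_def by blast
      from max[OF this sub] have "ann N ?z = ann N y" .
      moreover have "a \<in> ann N ?z" using ab y by (simp add: mem_ann_iff smult_assoc1)
      ultimately show ?thesis by blast
    qed simp
  qed
  then have "ann N y \<in> Ass N" using y(1) by (auto simp: mem_Ass_iff[OF N])
  with y(3) that show ?thesis by blast
qed

text \<open>The product of elements \<open>c\<^sub>g \<in> J g\<close> outside the prime \<open>p\<close> lies in every \<open>J g\<close> and
  outside \<open>p\<close>.\<close>

lemma finite_Inter_not_subset_prime:
  assumes p: "primeideal p R" and "finite A"
    and "\<And>g. g \<in> A \<Longrightarrow> ideal (J g) R" "\<And>g. g \<in> A \<Longrightarrow> \<not> J g \<subseteq> p"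
  shows "\<exists>c\<in>carrier R. c \<notin> p \<and> (\<forall>g\<in>A. c \<in> J g)"
  using assms(2-)
proof (induction A rule: finite_induct)
  case empty
  then show ?case
    using ideal.Icarr[OF primeideal.axioms(1)[OF p]] primeideal.I_notcarr[OF p] by blast
next
  case (insert g A)
  then obtain c where c: "c \<in> carrier R" "c \<notin> p" "\<forall>h\<in>A. c \<in> J h"
    by (metis insertCI)
  from insert.prems obtain d where d: "d \<in> J g" "d \<notin> p" by blast
  have ideals: "ideal (J h) R" if "h \<in> insert g A" for h
    using insert.prems(1) that .
  have dc: "d \<in> carrier R" using ideal.Icarr[OF ideals d(1)] by simp
  have "c \<otimes> d \<notin> p" using primeideal.I_prime[OF p c(1) dc] c(2) d(2) by blast
  moreover have "c \<otimes> d \<in> J g" using ideal.I_l_closed[OF ideals d(1) c(1)] by simp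
  moreover have "c \<otimes> d \<in> J h" if "h \<in> A" for h
    using ideal.I_r_closed[OF ideals _ dc] c(3) that by blast
  ultimately show ?case using c(1) dc by blast
qed

text \<open>If \<open>g\<^sub>1, \<dots>, g\<^sub>k\<close> generate \<open>I\<close>, then the annihilator of \<open>x\<close> modulo \<open>(N : I)\<close> is the
  intersection of the annihilators of the \<open>g\<^sub>i x\<close> modulo \<open>N\<close>. A prime that is a finite
  intersection of ideals is one of them.\<close>

lemma Ass_colon_submodule_subset:
  assumes N: "submodule N R M" and I: "ideal I R"
  shows "Ass (colon_submodule M N I) \<subseteq> Ass N"
proof
  fix r assume r: "r \<in> Ass (colon_submodule M N I)"
  have Ic: "I \<subseteq> carrier R" using ideal.Icarr[OF I] by blast
  from r obtain x where prime: "primeideal r R" and x: "x \<in> carrier M"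
    and rx: "r = ann (colon_submodule M N I) x"
    by (auto simp: mem_Ass_iff[OF submodule_colon_submodule[OF N Ic]])
  obtain A where A: "A \<subseteq> carrier R" "finite A" "I = Idl A"
    using finetely_gen[OF I] by blast
  have AI: "A \<subseteq> I" using genideal_self[OF A(1)] A(3) by simp
  have "\<exists>g\<in>A. ann N (g \<odot>\<^bsub>M\<^esub> x) \<subseteq> r"
  proof (rule ccontr)
    assume "\<not> ?thesis"
    \<comment> \<open>A single multiplier outside \<open>r\<close> then kills all \<open>g x\<close>, hence all of \<open>I x\<close>, modulo \<open>N\<close>.\<close>
    then have "\<exists>c\<in>carrier R. c \<notin> r \<and> (\<forall>g\<in>A. c \<in> ann N (g \<odot>\<^bsub>M\<^esub> x))"
      using A(1) x by (intro finite_Inter_not_subset_prime prime A(2) ideal_ann N) auto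
    then obtain c where c: "c \<in> carrier R" "c \<notin> r" "\<And>g. g \<in> A \<Longrightarrow> c \<odot>\<^bsub>M\<^esub> (g \<odot>\<^bsub>M\<^esub> x) \<in> N"
      by (auto simp: mem_ann_iff)
    have "A \<subseteq> ann N (c \<odot>\<^bsub>M\<^esub> x)"
      using c A(1) x smult_swap[OF c(1) _ x] by (auto simp: mem_ann_iff subset_iff)
    then have "I \<subseteq> ann N (c \<odot>\<^bsub>M\<^esub> x)"
      unfolding A(3) using c(1) x by (intro genideal_minimal ideal_ann N) auto
    then have "c \<in> r"
      using c(1) x by (auto simp: rx mem_ann_iff mem_colon_submodule_iff)
    with c(2) show False ..
  qed
  then obtain g where g: "g \<in> A" "ann N (g \<odot>\<^bsub>M\<^esub> x) \<subseteq> r" by blast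
  have gc: "g \<in> carrier R" using g(1) A(1) by blast
  have "r \<subseteq> ann N (g \<odot>\<^bsub>M\<^esub> x)"
  proof
    fix a assume "a \<in> r"
    then have a: "a \<in> carrier R" "g \<odot>\<^bsub>M\<^esub> (a \<odot>\<^bsub>M\<^esub> x) \<in> N"
      using g(1) AI by (auto simp: rx mem_ann_iff mem_colon_submodule_iff)
    then show "a \<in> ann N (g \<odot>\<^bsub>M\<^esub> x)"
      using smult_swap[OF gc a(1) x] by (simp add: mem_ann_iff)
  qed
  with g(2) have "r = ann N (g \<odot>\<^bsub>M\<^esub> x)" by blast
  then show "r \<in> Ass N" using prime gc x by (auto simp: mem_Ass_iff[OF N])
qed

text \<open>The annihilator of \<open>x\<close> modulo \<open>N \<inter> L\<close> is the intersection of its annihilators modulo \<open>N\<close>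
  and modulo \<open>L\<close>, and a prime that is an intersection of two ideals is one of them.\<close>

lemma Ass_Int_subset:
  assumes N: "submodule N R M" and L: "submodule L R M"
  shows "Ass (N \<inter> L) \<subseteq> Ass N \<union> Ass L"
proof
  fix r assume "r \<in> Ass (N \<inter> L)"
  then obtain x where prime: "primeideal r R" and x: "x \<in> carrier M"
    and "r = ann (N \<inter> L) x"
    by (auto simp: mem_Ass_iff[OF submodule_Int[OF N L]])
  then have rx: "r = ann N x \<inter> ann L x" by (auto simp: mem_ann_iff)
  have "ann N x \<subseteq> r \<or> ann L x \<subseteq> r"
  proof (rule ccontr)
    assume "\<not> ?thesis"
    then have "\<exists>c\<in>carrier R. c \<notin> r \<and> (\<forall>K\<in>{N, L}. c \<in> ann K x)"
      using x by (intro finite_Inter_not_subset_prime prime) (auto intro: ideal_ann N L)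
    then show False by (auto simp: rx)
  qed
  then have "r = ann N x \<or> r = ann L x" using rx by blast
  then show "r \<in> Ass N \<union> Ass L" using prime x by (auto simp: mem_Ass_iff N L)
qed

section \<open>Regular prime extensions\<close>

text \<open>For a maximal associated prime \<open>p\<close>, every element of \<open>(N : p)\<close> outside \<open>N\<close> has annihilator
  exactly \<open>p\<close> modulo \<open>N\<close>: the annihilator contains \<open>p\<close> and lies in some associated prime,
  which is \<open>p\<close> by maximality. Hence \<open>(N : p)\<close> is automatically a \<open>p\<close>-prime extension.\<close>

lemma regular_prime_extensionI:
  assumes N: "submodule N R M" and p: "p \<in> Ass N"
    and max: "\<And>q. q \<in> Ass N \<Longrightarrow> p \<subseteq> q \<Longrightarrow> q = p" and K: "K = colon_submodule M N p"
  shows "regular_prime_extension R M p N K"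
proof -
  obtain x where prime: "primeideal p R" and x: "x \<in> carrier M" and px: "p = ann N x"
    using p by (auto simp: mem_Ass_iff[OF N])
  have pc: "p \<subseteq> carrier R" using px by (auto simp: mem_ann_iff)
  have subK: "submodule K R M" unfolding K by (rule submodule_colon_submodule[OF N pc])
  have NK: "N \<subseteq> K" unfolding K by (rule subset_colon_submodule[OF N pc])
  have xK: "x \<in> K" using x by (auto simp: K mem_colon_submodule_iff px mem_ann_iff)
  have "\<one> \<notin> p"
    using ideal.one_imp_carrier[OF primeideal.axioms(1)[OF prime]] primeideal.I_notcarr[OF prime]
    by blast
  then have xN: "x \<notin> N" using x by (simp add: px mem_ann_iff)
  have annK: "ann N y = p" if y: "y \<in> K" "y \<notin> N" for y
  proof -
    have yc: "y \<in> carrier M" using y(1) by (simp add: K mem_colon_submodule_iff)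
    obtain q where q: "q \<in> Ass N" "ann N y \<subseteq> q"
      using ann_subset_associated_prime[OF N yc y(2)] .
    have "p \<subseteq> ann N y" using y(1) pc by (auto simp: K mem_colon_submodule_iff mem_ann_iff)
    then show ?thesis using q max by blast
  qed
  have colon: "colon_ideal R (M\<lparr>carrier := K\<rparr>) N K = p"
  proof
    show "colon_ideal R (M\<lparr>carrier := K\<rparr>) N K \<subseteq> p"
      using xK by (auto simp: px colon_ideal_def)
    show "p \<subseteq> colon_ideal R (M\<lparr>carrier := K\<rparr>) N K"
      using pc by (auto simp: colon_ideal_def K mem_colon_submodule_iff)
  qed
  have subN: "submodule N R (M\<lparr>carrier := K\<rparr>)"
  proof (rule module.submoduleI)
    show modK: "module R (M\<lparr>carrier := K\<rparr>)"
      by (rule submodule.submodule_is_module[OF subK module_axioms])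
    show "N \<subseteq> carrier (M\<lparr>carrier := K\<rparr>)" using NK by simp
    show "\<zero>\<^bsub>M\<lparr>carrier := K\<rparr>\<^esub> \<in> N" using zero_mem_submodule[OF N] by simp
    show "a \<oplus>\<^bsub>M\<lparr>carrier := K\<rparr>\<^esub> b \<in> N" if "a \<in> N" "b \<in> N" for a b
      using submoduleE(5)[OF N] that by simp
    show "a \<odot>\<^bsub>M\<lparr>carrier := K\<rparr>\<^esub> b \<in> N" if "a \<in> carrier R" "b \<in> N" for a b
      using submoduleE(4)[OF N] that by simp
    show "\<ominus>\<^bsub>M\<lparr>carrier := K\<rparr>\<^esub> a \<in> N" if "a \<in> N" for a
    proof -
      have aK: "a \<in> K" using that NK by blast
      \<comment> \<open>Negation in the smaller module is defined through its own carrier; scalar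
        multiplication is shared, so negation is expressed as multiplication by \<open>-1\<close>.\<close>
      have "\<ominus>\<^bsub>M\<lparr>carrier := K\<rparr>\<^esub> a = (\<ominus> \<one>) \<odot>\<^bsub>M\<lparr>carrier := K\<rparr>\<^esub> a"
        using module.smult_l_minus[OF modK, of \<one> a] module.smult_one[OF modK, of a] aK by simp
      then show ?thesis using submoduleE(4)[OF N, of "\<ominus> \<one>" a] that by simp
    qed
  qed
  have "prime_submodule R (M\<lparr>carrier := K\<rparr>) p N"
    unfolding prime_submodule_def
  proof (intro conjI ballI impI)
    show "submodule N R (M\<lparr>carrier := K\<rparr>)" by (rule subN)
    show "N \<noteq> carrier (M\<lparr>carrier := K\<rparr>)" using xK xN by auto
    show "colon_ideal R (M\<lparr>carrier := K\<rparr>) N (carrier (M\<lparr>carrier := K\<rparr>)) = p"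
      using colon by simp
    fix a y assume a: "a \<in> carrier R" and y: "y \<in> carrier (M\<lparr>carrier := K\<rparr>)"
      and ay: "a \<odot>\<^bsub>M\<lparr>carrier := K\<rparr>\<^esub> y \<in> N"
    then have "y \<notin> N \<Longrightarrow> a \<in> p" using annK[of y] by (auto simp: mem_ann_iff)
    then show "a \<in> colon_ideal R (M\<lparr>carrier := K\<rparr>) N (carrier (M\<lparr>carrier := K\<rparr>)) \<or> y \<in> N"
      using colon by auto
  qed
  then have "prime_extension R M p N K"
    unfolding prime_extension_def using N subK NK xK xN by blast
  then show ?thesis
    unfolding regular_prime_extension_def using p max K by simp
qed

lemma regular_prime_extensionD:
  assumes "regular_prime_extension R M p N K"
  shows "submodule N R M" "submodule K R M" "N \<subset> K" "p \<in> Ass N" "primeideal p R"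
    "\<And>q. q \<in> Ass N \<Longrightarrow> p \<subseteq> q \<Longrightarrow> q = p" "K = colon_submodule M N p" "p \<subseteq> carrier R"
proof -
  show N: "submodule N R M" and "submodule K R M" "N \<subset> K" and p: "p \<in> Ass N"
    "\<And>q. q \<in> Ass N \<Longrightarrow> p \<subseteq> q \<Longrightarrow> q = p" "K = colon_submodule M N p"
    using assms unfolding regular_prime_extension_def prime_extension_def by blast+
  show "primeideal p R" "p \<subseteq> carrier R"
    using p by (auto simp: mem_Ass_iff[OF N] mem_ann_iff)
qed

lemma colon_colon_submodule_commute:
  assumes "I \<subseteq> carrier R" "J \<subseteq> carrier R"
  shows "colon_submodule M (colon_submodule M N I) J = colon_submodule M (colon_submodule M N J) I"
proof -
  have "colon_submodule M (colon_submodule M N I) J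
      \<subseteq> colon_submodule M (colon_submodule M N J) I"
    if "I \<subseteq> carrier R" "J \<subseteq> carrier R" for I J
    using that smult_swap by (auto simp: mem_colon_submodule_iff subset_iff)
  then show ?thesis using assms by blast
qed

text \<open>A maximal associated prime \<open>q\<close> survives the step by another maximal associated prime \<open>p\<close>:
  if \<open>q\<close> is the annihilator of \<open>x\<close> modulo \<open>N\<close>, then \<open>a p x \<subseteq> N\<close> forces \<open>a \<in> q\<close> because \<open>p\<close> is
  not contained in \<open>q\<close>. So \<open>q\<close> is also the annihilator of \<open>x\<close> modulo \<open>(N : p)\<close>, and it stays maximal because the step creates no new associated primes.\<close>

lemma regular_prime_extension_persists:
  assumes p: "regular_prime_extension R M p N K" and q: "regular_prime_extension R M q N L"
    and neq: "p \<noteq> q"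
  shows "regular_prime_extension R M q K (colon_submodule M K q)"
proof -
  note P = regular_prime_extensionD[OF p] and Q = regular_prime_extensionD[OF q]
  have "\<not> p \<subseteq> q" using P(6)[OF Q(4)] neq by blast
  then obtain b where b: "b \<in> p" "b \<notin> q" by blast
  have bc: "b \<in> carrier R" using b(1) P(8) by blast
  obtain x where x: "x \<in> carrier M" "q = ann N x"
    using Q(4) by (auto simp: mem_Ass_iff[OF P(1)])
  have "q = ann K x"
  proof
    show "q \<subseteq> ann K x" using x P(3) by (auto simp: mem_ann_iff)
    show "ann K x \<subseteq> q"
    proof
      fix a assume a: "a \<in> ann K x"
      then have ac: "a \<in> carrier R" and "b \<odot>\<^bsub>M\<^esub> (a \<odot>\<^bsub>M\<^esub> x) \<in> N"
        using b(1) by (auto simp: P(7) mem_ann_iff mem_colon_submodule_iff)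
      then have "b \<otimes> a \<in> q" using bc x(1) by (simp add: x(2) mem_ann_iff smult_assoc1)
      then show "a \<in> q" using primeideal.I_prime[OF Q(5) bc ac] b(2) by blast
    qed
  qed
  then have "q \<in> Ass K" using Q(5) x(1) by (auto simp: mem_Ass_iff[OF P(2)])
  moreover have "Ass K \<subseteq> Ass N"
    using Ass_colon_submodule_subset[OF P(1) primeideal.axioms(1)[OF P(5)]] P(7) by simp
  ultimately show ?thesis
    using P(2) Q(6) by (intro regular_prime_extensionI) blast+
qed

lemma regular_prime_extension_diamond:
  assumes p: "regular_prime_extension R M p N K" and q: "regular_prime_extension R M q N L"
    and neq: "p \<noteq> q"
  obtains J where "regular_prime_extension R M q K J" "regular_prime_extension R M p L J"
proof
  show "regular_prime_extension R M q K (colon_submodule M K q)"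
    by (rule regular_prime_extension_persists[OF p q neq])
  have "colon_submodule M K q = colon_submodule M L p"
    using colon_colon_submodule_commute regular_prime_extensionD(7,8)[OF p]
      regular_prime_extensionD(7,8)[OF q] by metis
  then show "regular_prime_extension R M p L (colon_submodule M K q)"
    using regular_prime_extension_persists[OF q p] neq by simp
qed

lemma regular_prime_extension_exists:
  assumes N: "submodule N R M" and proper: "N \<noteq> carrier M"
  obtains p K where "regular_prime_extension R M p N K"
proof -
  obtain x where "x \<in> carrier M" "x \<notin> N" using submoduleE(1)[OF N] proper by blast
  then have "Ass N \<noteq> {}" using ann_subset_associated_prime[OF N] by blast
  have "\<exists>m\<in>Ass N. \<forall>q\<in>Ass N. m \<subseteq> q \<longrightarrow> q = m"
  proof (rule subset_Zorn_nonempty)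
    show "Ass N \<noteq> {}" by fact
    fix C assume C: "C \<noteq> {}" "subset.chain (Ass N) C"
    have "Ass N \<subseteq> {I. ideal I R}"
      by (auto simp: mem_Ass_iff[OF N] intro: primeideal.axioms(1))
    then have "subset.chain {I. ideal I R} C" using C(2) by (auto simp: subset_chain_def)
    from ideal_chain_is_trivial[OF C(1) this] show "\<Union>C \<in> Ass N"
      using C(2) by (auto simp: subset_chain_def)
  qed
  then obtain m where m: "m \<in> Ass N" "\<forall>q\<in>Ass N. m \<subseteq> q \<longrightarrow> q = m" ..
  have "regular_prime_extension R M m N (colon_submodule M N m)"
    by (rule regular_prime_extensionI[OF N m(1) _ refl]) (use m(2) in simp)
  then show ?thesis by (rule that)
qed

text \<open>Since \<open>(N \<inter> L : p)\<close> is the intersection of \<open>(N : p)\<close> and \<open>(L : p)\<close>, it equals \<open>K\<close>. What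
  needs an argument is that \<open>p\<close> is a maximal associated prime of \<open>N \<inter> L\<close>.
  No associated prime of \<open>N \<inter> L\<close> properly contains \<open>p\<close>, as it would be associated to \<open>N\<close> or to
  \<open>L\<close>. An element of \<open>K\<close> outside \<open>N \<inter> L\<close> is annihilated by \<open>p\<close>, and the associated prime above
  its annihilator must then be \<open>p\<close> itself.\<close>

lemma regular_prime_extension_Int:
  assumes N: "regular_prime_extension R M p N K" and L: "regular_prime_extension R M p L K"
  shows "regular_prime_extension R M p (N \<inter> L) K"
proof -
  note A = regular_prime_extensionD[OF N] and B = regular_prime_extensionD[OF L]
  have NL: "submodule (N \<inter> L) R M" by (rule submodule_Int[OF A(1) B(1)])
  have max: "q = p" if "q \<in> Ass (N \<inter> L)" "p \<subseteq> q" for q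
    using that Ass_Int_subset[OF A(1) B(1)] A(6) B(6) by blast
  have K: "K = colon_submodule M (N \<inter> L) p"
    using A(7) B(7) by (auto simp: colon_submodule_def)
  obtain x where x: "x \<in> K" "x \<notin> N \<inter> L" using A(3) by blast
  have xc: "x \<in> carrier M" using x(1) by (simp add: K mem_colon_submodule_iff)
  obtain q where q: "q \<in> Ass (N \<inter> L)" "ann (N \<inter> L) x \<subseteq> q"
    using ann_subset_associated_prime[OF NL xc x(2)] .
  have "p \<subseteq> ann (N \<inter> L) x"
    using x(1) A(8) by (auto simp: K mem_colon_submodule_iff mem_ann_iff)
  with q max have "p \<in> Ass (N \<inter> L)" by blast
  then show ?thesis by (rule regular_prime_extensionI[OF NL _ max K])
qed

section \<open>Existence and uniqueness of the factorization\<close>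

lemma rpe_filtration_carrier:
  "rpe_filtration R M (carrier M) [carrier M] []"
  by (simp add: rpe_filtration_def)

lemma rpe_filtration_Cons:
  assumes "regular_prime_extension R M p N K" "rpe_filtration R M K Ms ps"
  shows "rpe_filtration R M N (N # Ms) (p # ps)"
proof -
  have ne: "Ms \<noteq> []" using assms(2) by (auto simp: rpe_filtration_def)
  then have "Ms ! 0 = K" using assms(2) by (simp add: rpe_filtration_def hd_conv_nth)
  then show ?thesis
    using assms ne by (auto simp: rpe_filtration_def nth_Cons split: nat.split)
qed

text \<open>With \<open>rpe_filtration_Cons\<close> this replaces list positions by recursion on the first step, the
  form needed for induction on \<open>N\<close>.\<close>

lemma rpe_filtration_cases:
  assumes "rpe_filtration R M N Ms ps"
  obtains "N = carrier M" "ps = []"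
  | p K Ms' ps' where "ps = p # ps'" "regular_prime_extension R M p N K"
      "rpe_filtration R M K Ms' ps'"
proof (cases ps)
  case Nil
  then obtain K where "Ms = [K]" using assms by (auto simp: rpe_filtration_def length_Suc_conv)
  then show ?thesis using assms Nil that(1) by (auto simp: rpe_filtration_def)
next
  case (Cons p ps')
  then obtain Ms' where Ms: "Ms = N # Ms'" "length Ms' = Suc (length ps')"
    using assms by (auto simp: rpe_filtration_def length_Suc_conv)
  have step: "regular_prime_extension R M ((p # ps') ! i) ((N # Ms') ! i) ((N # Ms') ! Suc i)"
    if "i < Suc (length ps')" for i
    using assms that by (simp add: rpe_filtration_def Ms(1) Cons)
  have ne: "Ms' \<noteq> []" using Ms(2) by auto
  have "regular_prime_extension R M p N (hd Ms')"
    using step[of 0] ne by (simp add: hd_conv_nth)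
  moreover have "regular_prime_extension R M (ps' ! i) (Ms' ! i) (Ms' ! Suc i)"
    if "i < length ps'" for i
    using step[of "Suc i"] that by simp
  then have "rpe_filtration R M (hd Ms') Ms' ps'"
    using assms ne Ms(2) by (simp add: rpe_filtration_def Ms(1))
  ultimately show ?thesis using that(2) Cons by blast
qed

text \<open>The diamond property makes the choice of the first prime irrelevant: two different first
  steps \<open>p\<close> and \<open>q\<close> continue to a common submodule by \<open>q\<close> and \<open>p\<close>. Induction along the ascending
  chain condition turns this local statement into uniqueness of the whole multiset.\<close>

lemma rpe_filtration_exists_unique:
  assumes "submodule N R M"
  shows "\<exists>!A. \<exists>Ms ps. rpe_filtration R M N Ms ps \<and> A = mset ps"
  using assms
proof (induction N rule: wf_induct_rule[OF wf_submodules])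
  case (1 N)
  show ?case
  proof (cases "N = carrier M")
    case True
    have "ps = []" if "rpe_filtration R M N Ms ps" for Ms ps
      using that
    proof (cases rule: rpe_filtration_cases)
      case (2 p K)
      then show ?thesis
        using regular_prime_extensionD(2,3)[of p N K] submoduleE(1)[of K] True by blast
    qed
    then show ?thesis using rpe_filtration_carrier True by (intro ex1I[of _ "{#}"]) auto
  next
    case False
    have larger: "\<exists>!A. \<exists>Ms ps. rpe_filtration R M K Ms ps \<and> A = mset ps"
      if "submodule K R M" "N \<subset> K" for K
      using 1(1)[of K] 1(2) that by simp
    have IH: "\<exists>!A. \<exists>Ms ps. rpe_filtration R M K Ms ps \<and> A = mset ps"
      if "regular_prime_extension R M p N K" for p K
      by (rule larger[OF regular_prime_extensionD(2,3)[OF that]])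
    obtain p K where p: "regular_prime_extension R M p N K"
      using regular_prime_extension_exists[OF 1(2) False] .
    from IH[OF p] obtain Ms ps where ps: "rpe_filtration R M K Ms ps" by blast
    have uniq: "mset qs' = add_mset p (mset ps)" if "rpe_filtration R M N Ms' qs'" for Ms' qs'
      using that
    proof (cases rule: rpe_filtration_cases)
      case (2 q L Ls qs)
      show ?thesis
      proof (cases "p = q")
        case True
        then have "L = K"
          using regular_prime_extensionD(7)[OF 2(2)] regular_prime_extensionD(7)[OF p] by simp
        then have "mset qs = mset ps" using IH[OF p] ps 2(3) by blast
        then show ?thesis using 2(1) True by simp
      next
        case neq: False
        obtain J where J: "regular_prime_extension R M q K J" "regular_prime_extension R M p L J"
          using regular_prime_extension_diamond[OF p 2(2) neq] .
        have "N \<subset> J"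
          using regular_prime_extensionD(3)[OF p] regular_prime_extensionD(3)[OF J(1)] by simp
        from larger[OF regular_prime_extensionD(2)[OF J(1)] this]
        obtain Js rs where rs: "rpe_filtration R M J Js rs" by blast
        have "mset ps = mset (q # rs)"
          using IH[OF p] ps rpe_filtration_Cons[OF J(1) rs] by blast
        moreover have "mset qs = mset (p # rs)"
          using IH[OF 2(2)] 2(3) rpe_filtration_Cons[OF J(2) rs] by blast
        ultimately show ?thesis using 2(1) by simp
      qed
    qed (use False in simp)
    have "rpe_filtration R M N (N # Ms) (p # ps)" by (rule rpe_filtration_Cons[OF p ps])
    then show ?thesis
      using uniq by (intro ex1I[of _ "mset (p # ps)"]) (blast, auto)
  qed
qed

lemma gen_prime_factorization_eq_mset:
  assumes "submodule N R M" "rpe_filtration R M N Ms ps"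
  shows "gen_prime_factorization R M N = mset ps"
  unfolding gen_prime_factorization_def
  by (rule the1_equality[OF rpe_filtration_exists_unique[OF assms(1)]]) (use assms(2) in blast)

lemma gen_prime_factorization_carrier:
  "gen_prime_factorization R M (carrier M) = {#}"
  using gen_prime_factorization_eq_mset[OF carrier_is_submodule rpe_filtration_carrier] by simp

lemma gen_prime_factorization_step:
  assumes "regular_prime_extension R M p N K"
  shows "gen_prime_factorization R M N = add_mset p (gen_prime_factorization R M K)"
proof -
  note D = regular_prime_extensionD[OF assms]
  obtain Ms ps where ps: "rpe_filtration R M K Ms ps"
    using rpe_filtration_exists_unique[OF D(2)] by blast
  show ?thesis
    using gen_prime_factorization_eq_mset[OF D(2) ps]
      gen_prime_factorization_eq_mset[OF D(1) rpe_filtration_Cons[OF assms ps]] by simp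
qed

lemma gen_prime_factorization_empty_iff:
  assumes "submodule N R M"
  shows "gen_prime_factorization R M N = {#} \<longleftrightarrow> N = carrier M"
  using regular_prime_extension_exists[OF assms] gen_prime_factorization_step
    gen_prime_factorization_carrier by (metis add_mset_not_empty)

lemma gen_prime_factorization_Int:
  assumes "regular_prime_extension R M p N K" "regular_prime_extension R M p L K"
  shows "gen_prime_factorization R M (N \<inter> L) = gen_prime_factorization R M N"
  using gen_prime_factorization_step[OF assms(1)]
    gen_prime_factorization_step[OF regular_prime_extension_Int[OF assms]] by simp

end

section \<open>Ideals of a Noetherian ring\<close>

lemma self_module_simps [simp]:
  "carrier (self_module R) = carrier R" "smult (self_module R) = monoid.mult R"
  by (simp_all add: self_module_def)

locale noetherian_cring = cring + noetherian_ring
begin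

lemma noetherian_module_self_module: "noetherian_module R (self_module R)"
proof (intro noetherian_module.intro noetherian_module_axioms.intro)
  show "module R (self_module R)" by (rule module_self_module[OF is_cring])
  show "noetherian_ring R" by (rule noetherian_ring_axioms)
  have "wf {(J, I). ideal I R \<and> ideal J R \<and> I \<subset> J}"
  proof (rule wfI_min)
    fix I :: "'a set" and Q assume I: "I \<in> Q"
    show "\<exists>J\<in>Q. \<forall>K. (K, J) \<in> {(J, I). ideal I R \<and> ideal J R \<and> I \<subset> J} \<longrightarrow> K \<notin> Q"
    proof (cases "Q \<inter> {I. ideal I R} = {}")
      case True
      then show ?thesis using I by blast
    next
      case False
      have "\<exists>J\<in>Q \<inter> {I. ideal I R}. \<forall>K\<in>Q \<inter> {I. ideal I R}. J \<subseteq> K \<longrightarrow> K = J"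
      proof (rule subset_Zorn_nonempty[OF False])
        fix C assume C: "C \<noteq> {}" "subset.chain (Q \<inter> {I. ideal I R}) C"
        then have "subset.chain {I. ideal I R} C" by (auto simp: subset_chain_def)
        from ideal_chain_is_trivial[OF C(1) this] show "\<Union>C \<in> Q \<inter> {I. ideal I R}"
          using C(2) by (auto simp: subset_chain_def)
      qed
      then show ?thesis by blast
    qed
  qed
  then show "wf {(K, N). submodule N R (self_module R) \<and> submodule K R (self_module R) \<and> N \<subset> K}"
    by (simp add: submodule_self_module_iff[OF is_cring])
qed

sublocale self: noetherian_module R "self_module R"
  by (rule noetherian_module_self_module)

abbreviation factorization :: "'a set \<Rightarrow> 'a set multiset" where
  "factorization I \<equiv> gen_prime_factorization R (self_module R) I"

abbreviation regular_step :: "'a set \<Rightarrow> 'a set \<Rightarrow> 'a set \<Rightarrow> bool" where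
  "regular_step p I K \<equiv> regular_prime_extension R (self_module R) p I K"

lemma submodule_iff_ideal: "submodule I R (self_module R) \<longleftrightarrow> ideal I R"
  by (rule submodule_self_module_iff[OF is_cring])

text \<open>In \<open>M = R\<close> the annihilator of an element modulo \<open>I\<close> contains \<open>I\<close>.\<close>

lemma regular_step_subset_prime:
  assumes "regular_step p I K"
  shows "I \<subseteq> p"
proof -
  note D = self.regular_prime_extensionD[OF assms]
  have I: "ideal I R" using D(1) by (simp add: submodule_iff_ideal)
  obtain x where "x \<in> carrier R" "p = self.ann I x"
    using D(4) by (auto simp: self.mem_Ass_iff[OF D(1)])
  then show ?thesis
    using ideal.I_r_closed[OF I] ideal.Icarr[OF I] by (auto simp: self.mem_ann_iff)
qed

text \<open>\<open>(I : p) = R\<close> says \<open>p \<subseteq> I\<close>.\<close>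

lemma regular_step_carrier:
  assumes "regular_step p I (carrier R)"
  shows "I = p"
proof
  note D = self.regular_prime_extensionD[OF assms]
  show "I \<subseteq> p" by (rule regular_step_subset_prime[OF assms])
  have "\<one> \<in> colon_submodule (self_module R) I p" using D(7) by auto
  then show "p \<subseteq> I" using D(8) by (auto simp: self.mem_colon_submodule_iff subset_iff)
qed

lemma factorization_singletonD:
  assumes I: "ideal I R" and eq: "factorization I = {#p#}"
  shows "regular_step p I (carrier R)"
proof -
  have sub: "submodule I R (self_module R)" using I by (simp add: submodule_iff_ideal)
  have "I \<noteq> carrier R"
    using self.gen_prime_factorization_empty_iff[OF sub] eq by auto
  then obtain q K where q: "regular_step q I K"
    using self.regular_prime_extension_exists[OF sub] by auto
  have "q = p" "factorization K = {#}"
    using self.gen_prime_factorization_step[OF q] eq by auto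
  moreover have "K = carrier R"
    using self.gen_prime_factorization_empty_iff[OF self.regular_prime_extensionD(2)[OF q]]
      calculation(2) by simp
  ultimately show ?thesis using q by simp
qed

text \<open>After the first step by \<open>p\<close> the remaining factorization is \<open>{#q#}\<close>, so the ideal reached
  is \<open>q\<close> itself. The multiset does not record which of the two primes came first.\<close>

lemma factorization_pairD:
  assumes I: "ideal I R" and eq: "factorization I = {#p, q#}"
  shows "regular_step p I q \<or> regular_step q I p"
proof -
  have sub: "submodule I R (self_module R)" using I by (simp add: submodule_iff_ideal)
  have "I \<noteq> carrier R"
    using self.gen_prime_factorization_empty_iff[OF sub] eq by auto
  then obtain r K where r: "regular_step r I K"
    using self.regular_prime_extension_exists[OF sub] by auto
  have K: "ideal K R"
    using self.regular_prime_extensionD(2)[OF r] by (simp add: submodule_iff_ideal)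
  have "add_mset r (factorization K) = {#p, q#}"
    using self.gen_prime_factorization_step[OF r] eq by simp
  then have "r = p \<and> factorization K = {#q#} \<or> r = q \<and> factorization K = {#p#}"
    by (auto simp: add_eq_conv_ex)
  moreover have "K = s" if "factorization K = {#s#}" for s
    using regular_step_carrier[OF factorization_singletonD[OF K that]] .
  ultimately show ?thesis using r by blast
qed

text \<open>The prime \<open>q\<close> is associated to \<open>R/q\<close>, and a step creates no new associated primes.\<close>

lemma prime_mem_Ass_of_regular_step:
  assumes step: "regular_step p I q" and q: "primeideal q R"
  shows "q \<in> self.Ass I"
proof -
  note D = self.regular_prime_extensionD[OF step]
  have "q = self.ann q \<one>"
    using ideal.Icarr[OF primeideal.axioms(1)[OF q]] by (auto simp: self.mem_ann_iff)
  then have "q \<in> self.Ass q"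
    using q by (auto simp: self.mem_Ass_iff[OF D(2)])
  then show ?thesis
    using self.Ass_colon_submodule_subset[OF D(1) primeideal.axioms(1)[OF D(5)]] D(7) by auto
qed

text \<open>Since \<open>p q \<subseteq> I \<subseteq> p\<close> and \<open>q\<close> is not contained in \<open>p\<close>, primality of \<open>p\<close> gives \<open>(I : q) = p\<close>.
  The prime \<open>q\<close> is maximal in \<open>Ass (R/I)\<close>: let \<open>r \<supseteq> q\<close> be the annihilator of \<open>x\<close> modulo \<open>I\<close>.
  If \<open>x \<in> q = (I : p)\<close>, then \<open>p \<subseteq> r\<close>, so \<open>r = p\<close> by maximality of \<open>p\<close>, which is
  impossible as \<open>r\<close> contains \<open>q\<close> and \<open>p\<close> does not; if \<open>x \<notin> q\<close>, then \<open>r x \<subseteq> I \<subseteq> q\<close> forces \<open>r \<subseteq> q\<close>.\<close>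

lemma regular_step_swap:
  assumes step: "regular_step p I q" and q: "primeideal q R" and nsub: "\<not> q \<subseteq> p"
  shows "regular_step q I p"
proof -
  note D = self.regular_prime_extensionD[OF step]
  have Ip: "I \<subseteq> p" by (rule regular_step_subset_prime[OF step])
  have qc: "q \<subseteq> carrier R" using ideal.Icarr[OF primeideal.axioms(1)[OF q]] by blast
  obtain b where b: "b \<in> q" "b \<notin> p" using nsub by blast
  have pq: "p = colon_submodule (self_module R) I q"
  proof
    show "p \<subseteq> colon_submodule (self_module R) I q"
    proof
      fix x assume x: "x \<in> p"
      then have "y \<otimes> x \<in> I" if "y \<in> q" for y
        using that D(7,8) qc m_comm[of x y]
        by (auto simp: self.mem_colon_submodule_iff subset_iff)
      then show "x \<in> colon_submodule (self_module R) I q"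
        using x D(8) by (auto simp: self.mem_colon_submodule_iff)
    qed
    show "colon_submodule (self_module R) I q \<subseteq> p"
    proof
      fix x assume "x \<in> colon_submodule (self_module R) I q"
      then have "x \<in> carrier R" "b \<otimes> x \<in> p"
        using b(1) Ip by (auto simp: self.mem_colon_submodule_iff)
      then show "x \<in> p" using primeideal.I_prime[OF D(5), of b x] b qc by blast
    qed
  qed
  have max: "r = q" if r: "r \<in> self.Ass I" "q \<subseteq> r" for r
  proof -
    obtain x where x: "x \<in> carrier R" "r = self.ann I x"
      using r(1) by (auto simp: self.mem_Ass_iff[OF D(1)])
    show ?thesis
    proof (cases "x \<in> q")
      case True
      then have "p \<subseteq> r"
        using D(7,8) x(2) by (auto simp: self.mem_colon_submodule_iff self.mem_ann_iff)
      then have "r = p" by (rule D(6)[OF r(1)])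
      then show ?thesis using r(2) nsub by blast
    next
      case False
      have "r \<subseteq> q"
      proof
        fix a assume "a \<in> r"
        then have "a \<in> carrier R" "a \<otimes> x \<in> q"
          using x(2) D(3) by (auto simp: self.mem_ann_iff)
        then show "a \<in> q" using primeideal.I_prime[OF q, of a x] x(1) False by blast
      qed
      then show ?thesis using r(2) by blast
    qed
  qed
  show ?thesis
    by (rule self.regular_prime_extensionI[OF D(1)
          prime_mem_Ass_of_regular_step[OF step q] max pq])
qed

lemma common_regular_step:
  assumes I: "ideal I R" and J: "ideal J R" and proper: "I \<noteq> carrier R"
    and eq: "factorization I = factorization J" and size: "size (factorization I) \<le> 2"
  obtains p K where "regular_step p I K" "regular_step p J K"
proof -
  note common = that
  have "factorization I \<noteq> {#}"
    using self.gen_prime_factorization_empty_iff[of I] I proper by (simp add: submodule_iff_ideal)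
  then have "size (factorization I) = 1 \<or> size (factorization I) = 2"
    using size by (metis One_nat_def le_SucE le_zero_eq numeral_2_eq_2 size_eq_0_iff_empty)
  then show ?thesis
  proof
    assume "size (factorization I) = 1"
    then obtain p where "factorization I = {#p#}" using size_1_singleton_mset by blast
    then show ?thesis using factorization_singletonD I J eq that by metis
  next
    assume "size (factorization I) = 2"
    then obtain p q where pq: "factorization I = {#p, q#}"
      by (metis One_nat_def numeral_2_eq_2 size_1_singleton_mset size_eq_Suc_imp_eq_union
        size_add_mset Suc_inject)
    \<comment> \<open>If the primes occur in opposite orders, either they coincide or the steps over \<open>I\<close> can be
      interchanged.\<close>
    have crossed: thesis if p: "regular_step p I q" and q: "regular_step q J p" for p q
    proof (cases "q \<subseteq> p")
      case True
      have "p \<in> self.Ass J"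
        using prime_mem_Ass_of_regular_step[OF q] self.regular_prime_extensionD(5)[OF p] by blast
      then have "p = q" using self.regular_prime_extensionD(6)[OF q] True by blast
      then show ?thesis using common p q by blast
    next
      case False
      then have "regular_step q I p"
        using regular_step_swap[OF p] self.regular_prime_extensionD(5)[OF q] by blast
      then show ?thesis using common q by blast
    qed
    have "regular_step p I q \<or> regular_step q I p" "regular_step p J q \<or> regular_step q J p"
      using factorization_pairD[OF I pq] factorization_pairD[OF J] pq eq by simp_all
    then show ?thesis using crossed[of p q] crossed[of q p] common by blast
  qed
qed

end

theorem proposition2p1:
  fixes R :: "('a, 'm) ring_scheme" and \<aa> \<bb> :: "'a set"
  assumes "cring R" and "noetherian_ring R"
    and "ideal \<aa> R" and "\<aa> \<noteq> carrier R"
    and "ideal \<bb> R" and "\<bb> \<noteq> carrier R"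
    and "gen_prime_factorization R (self_module R) \<aa> =
         gen_prime_factorization R (self_module R) \<bb>"
    and "size (gen_prime_factorization R (self_module R) \<aa>) \<le> 2"
  shows "gen_prime_factorization R (self_module R) (\<aa> \<inter> \<bb>) =
         gen_prime_factorization R (self_module R) \<aa>"
proof -
  interpret noetherian_cring R
    using assms(1,2) by (simp add: noetherian_cring_def)
  obtain p K where "regular_step p \<aa> K" "regular_step p \<bb> K"
    using common_regular_step[OF assms(3,5,4,7,8)] .
  then show ?thesis by (rule self.gen_prime_factorization_Int)
qed

end
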